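(* Let $n\ge1$, let $\mathbf{m}=(m_1,\ldots,m_n)$ be a vector of positive integers with $m_1+m_2+\cdots+m_n=m$, and let $0\le i\le m-1$. Then the polynomial $$S_{\mathbf{m},i}(x)=\sum_{\substack{\pi\in\mathcal{Q}_{\mathbf{m}}\\ \mathrm{plat}(\pi)=i}}x^{\mathrm{des}(\pi)}$$ has only real roots.
   Context: For a vector $\mathbf{m}=(m_1,\ldots,m_n)$ of positive integers, $M_{\mathbf{m}}=\{1^{m_1},2^{m_2},\ldots,n^{m_n}\}$ is the multiset in which $k$ appears $m_k$ times. A generalized Stirling permutation of $M_{\mathbf{m}}$ is a word $\pi=\pi_1\pi_2\cdots\pi_m$ (with $m=\sum_k m_k$) that is a permutation of the multiset $M_{\mathbf{m}}$ such that, for each $k\in\{1,\ldots,n\}$, all entries located between any two occurrences of $k$ are larger than or equal to $k$ (equivalently, all entries different from $k$ between two occurrences of $k$ are larger than $k$). $\mathcal{Q}_{\mathbf{m}}$ denotes the set of all generalized Stirling permutations of $M_{\mathbf{m}}$. Convention: $\pi_0=\pi_{m+1}=0$. An index $j$, $0\le j\le m$, is a plateau (resp. descent) of $\pi$ if $\pi_j=\pi_{j+1}$ (resp. $\pi_j>\pi_{j+1}$). $\mathrm{plat}(\pi)$ and $\mathrm{des}(\pi)$ are the numbers of plateaux and descents of $\pi$. "Has only real roots" means all complex roots are real; by convention the zero polynomial (which occurs when no $\pi\in\mathcal{Q}_{\mathbf{m}}$ has $\mathrm{plat}(\pi)=i$) is regarded as having only real roots. *)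

theory Defs
  imports
    Complex_Main
    "HOL-Computational_Algebra.Polynomial"
    "HOL-Combinatorics.Multiset_Permutations"
begin

text \<open>The vector of multiplicities is a function \<open>m\<close> of which only the values
  \<open>m 1, \<dots>, m n\<close> are relevant.\<close>

definition stirling_mset :: "nat \<Rightarrow> (nat \<Rightarrow> nat) \<Rightarrow> nat multiset" where
  "stirling_mset n m = (\<Sum>k\<in>{1..n}. replicate_mset (m k) k)"

definition stirling_perms :: "nat \<Rightarrow> (nat \<Rightarrow> nat) \<Rightarrow> nat list set" where
  "stirling_perms n m =
     {\<pi> \<in> permutations_of_multiset (stirling_mset n m).
        \<forall>k\<in>{1..n}. \<forall>a b c. a < b \<longrightarrow> b < c \<longrightarrow> c < length \<pi> \<longrightarrow>
          \<pi> ! a = k \<longrightarrow> \<pi> ! c = k \<longrightarrow> k \<le> \<pi> ! b}"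

text \<open>\<open>pad \<pi> ! j\<close> is the letter \<open>\<pi>\<^sub>j\<close> in one-based indexing for \<open>0 \<le> j \<le> length \<pi> + 1\<close>,
  with the convention that the letters at positions \<open>0\<close> and \<open>length \<pi> + 1\<close> are \<open>0\<close>.\<close>

definition pad :: "nat list \<Rightarrow> nat list" where
  "pad \<pi> = 0 # \<pi> @ [0]"

definition plat :: "nat list \<Rightarrow> nat" where
  "plat \<pi> = card {j \<in> {0..length \<pi>}. pad \<pi> ! j = pad \<pi> ! (j + 1)}"

definition des :: "nat list \<Rightarrow> nat" where
  "des \<pi> = card {j \<in> {0..length \<pi>}. pad \<pi> ! j > pad \<pi> ! (j + 1)}"

definition stirling_poly :: "nat \<Rightarrow> (nat \<Rightarrow> nat) \<Rightarrow> nat \<Rightarrow> real poly" where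
  "stirling_poly n m i =
     (\<Sum>\<pi> \<in> {\<pi> \<in> stirling_perms n m. plat \<pi> = i}. monom 1 (des \<pi>))"

text \<open>All complex roots are real; the zero polynomial counts as real-rooted by convention.\<close>

definition only_real_roots :: "real poly \<Rightarrow> bool" where
  "only_real_roots p \<longleftrightarrow>
     p = 0 \<or> (\<forall>z::complex. poly (map_poly complex_of_real p) z = 0 \<longrightarrow> z \<in> \<real>)"

end

theory Submission
  imports
    Defs
    "HOL-Library.Sublist"
    "HOL-Computational_Algebra.Fundamental_Theorem_Algebra"
    "HOL-Complex_Analysis.Great_Picard"
begin

text \<open>The proof goes through the trivariate refinement
  \[ F_n(x,y,z) = \sum_\pi x^{\mathrm{des}(\pi)} y^{\mathrm{asc}(\pi)} z^{\mathrm{plat}(\pi)}, \]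
  where \<open>\<pi>\<close> ranges over the generalized Stirling permutations on the letters
  \<open>1, \<dots>, n\<close>. The \<open>m (n + 1)\<close> copies of the largest letter \<open>n + 1\<close> form one contiguous block, and
  this block can be inserted at any position of a permutation of the smaller letters. Inserting it
  replaces one descent, ascent or plateau by one ascent, \<open>m (n + 1) - 1\<close> plateaux and one descent,
  so that
  \[ F_{n+1} = x\,y\,z^{m_{n+1}-1}\,(\partial_x + \partial_y + \partial_z)\,F_n,
     \qquad F_0 = z. \]
  This is \<open>stirling_sum_Suc\<close>, stated along the line \<open>t \<mapsto> (x + t, y + t, z + t)\<close>, where the
  differential operator becomes the derivative in \<open>t\<close>.

  If all roots of a nonconstant complex polynomial lie in the open lower half-plane, then so do those
  of its derivative, because the logarithmic derivative \<open>\<Sum>\<^sub>r 1 / (t - r)\<close> has negative imaginary part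
  for \<open>Im t \<ge> 0\<close>. By induction, \<open>F\<^sub>n\<close> has no zero with all three arguments in the open upper
  half-plane (\<open>stirling_sum_stable\<close>).

  It remains to extract the coefficient of \<open>z\<^sup>i\<close> at \<open>y = 1\<close>. For \<open>\<delta> > 0\<close> and \<open>Im x > 0\<close>, the polynomial
  \<open>F\<^sub>n(x + \<delta>t, 1 + \<i>\<delta> + \<delta>t, \<i>\<delta> + t)\<close> in \<open>t\<close> has all its roots in the open lower half-plane, hence so
  do its nonconstant derivatives, and none of its coefficients up to its degree vanishes. As
  \<open>\<delta> \<rightarrow> 0\<close>, its \<open>i\<close>-th coefficient tends, locally uniformly in \<open>x\<close>, to the polynomial under
  consideration, which by Hurwitz's theorem is zero or has no root in the open upper half-plane.
  Complex conjugation excludes the lower half-plane.\<close>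

section \<open>Polynomials without roots in the closed upper half-plane\<close>

lemma Im_logderiv_nonpos:
  fixes p :: "complex poly"
  assumes "p \<noteq> 0" "\<And>t. Im t \<ge> 0 \<Longrightarrow> poly p t \<noteq> 0" "Im t \<ge> 0"
  shows "Im (poly (pderiv p) t / poly p t) \<le> 0 \<and>
         (degree p > 0 \<longrightarrow> Im (poly (pderiv p) t / poly p t) < 0)"
  using assms
proof (induction "degree p" arbitrary: p)
  case 0
  then have "pderiv p = 0"
    by (simp add: pderiv_eq_0_iff)
  with 0 show ?case by simp
next
  case (Suc d)
  then obtain r where r: "poly p r = 0"
    using alg_closed_imp_poly_has_root[of p] by auto
  then obtain q where q: "p = [:-r, 1:] * q"
    by (metis dvdE poly_eq_0_iff_dvd)
  have q0: "q \<noteq> 0" using Suc.prems(1) q by auto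
  have "degree p = Suc (degree q)"
    unfolding q using q0 by (subst degree_mult_eq) auto
  then have dq: "d = degree q" using Suc.hyps(2) by simp
  have qr: "poly q u \<noteq> 0" if "Im u \<ge> 0" for u
    using Suc.prems(2)[OF that] q by auto
  have IH: "Im (poly (pderiv q) t / poly q t) \<le> 0"
    using Suc.hyps(1)[OF dq q0 qr Suc.prems(3)] by blast
  have r_neg: "Im r < 0"
    using Suc.prems(2)[of r] r by force
  have tr: "t - r \<noteq> 0"
    using r_neg Suc.prems(3) by auto
  have "poly (pderiv p) t / poly p t = 1 / (t - r) + poly (pderiv q) t / poly q t"
    unfolding q pderiv_mult using tr qr[OF Suc.prems(3)]
    by (simp add: pderiv_pCons field_simps)
  moreover have "Im (1 / (t - r)) < 0"
  proof -
    have "Im (1 / (t - r)) = - Im (t - r) / (cmod (t - r))\<^sup>2"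
      by (simp add: Im_divide cmod_power2)
    also have "\<dots> < 0"
      using tr r_neg Suc.prems(3) by (intro divide_neg_pos) auto
    finally show ?thesis .
  qed
  ultimately show ?case using IH by simp
qed

lemma pderiv_no_roots:
  fixes p :: "complex poly"
  assumes "degree p > 0" "\<And>t. Im t \<ge> 0 \<Longrightarrow> poly p t \<noteq> 0" "Im t \<ge> 0"
  shows "poly (pderiv p) t \<noteq> 0"
  using Im_logderiv_nonpos[of p t] assms by force

text \<open>The \<open>i\<close>-th coefficient is, up to the factor \<open>i!\<close>, the value at \<open>0\<close> of the \<open>i\<close>-th derivative.\<close>

lemma coeff_nonzero_of_no_roots:
  fixes p :: "complex poly"
  assumes "\<And>t. Im t \<ge> 0 \<Longrightarrow> poly p t \<noteq> 0" "i \<le> degree p"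
  shows "coeff p i \<noteq> 0"
  using assms
proof (induction i arbitrary: p)
  case 0
  then show ?case using 0(1)[of 0] by (simp add: poly_0_coeff_0)
next
  case (Suc i)
  have "coeff (pderiv p) i \<noteq> 0"
    using Suc.prems pderiv_no_roots[of p]
    by (intro Suc.IH) (auto simp: degree_pderiv)
  then show ?case by (simp add: coeff_pderiv)
qed

section \<open>Weights of words\<close>

text \<open>The weight of two neighbouring letters \<open>a b\<close>: \<open>x\<close> for a descent, \<open>y\<close> for an ascent, \<open>z\<close> for a
  plateau.\<close>

definition step_weight :: "'a \<Rightarrow> 'a \<Rightarrow> 'a \<Rightarrow> nat \<Rightarrow> nat \<Rightarrow> 'a" where
  "step_weight x y z a b = (if b < a then x else if a < b then y else z)"

text \<open>The product of the weights of all neighbouring pairs in the word \<open>a \<pi> 0\<close>. For \<open>a = 0\<close> this is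
  the padded word, and the weight is \<open>x\<close>, \<open>y\<close>, \<open>z\<close> to the numbers of descents, ascents and plateaux
  of \<open>\<pi>\<close>. The arguments may themselves be polynomials, which is how the weight is restricted to a
  line.\<close>

fun word_weight :: "'a::comm_semiring_1 \<Rightarrow> 'a \<Rightarrow> 'a \<Rightarrow> nat \<Rightarrow> nat list \<Rightarrow> 'a" where
  "word_weight x y z a [] = step_weight x y z a 0"
| "word_weight x y z a (b # \<pi>) = step_weight x y z a b * word_weight x y z b \<pi>"

text \<open>The trivariate generating polynomial \<open>F\<^sub>n(x, y, z)\<close>.\<close>

definition stirling_sum ::
    "'a::comm_semiring_1 \<Rightarrow> 'a \<Rightarrow> 'a \<Rightarrow> nat \<Rightarrow> (nat \<Rightarrow> nat) \<Rightarrow> 'a" where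
  "stirling_sum x y z n m = (\<Sum>\<pi>\<in>stirling_perms n m. word_weight x y z 0 \<pi>)"

lemma poly_word_weight:
  "poly (word_weight X Y Z a \<pi>) t = word_weight (poly X t) (poly Y t) (poly Z t) a \<pi>"
  by (induction \<pi> arbitrary: a) (auto simp: step_weight_def)

lemma poly_stirling_sum:
  "poly (stirling_sum X Y Z n m) t = stirling_sum (poly X t) (poly Y t) (poly Z t) n m"
  by (simp add: stirling_sum_def poly_sum poly_word_weight)

lemma word_weight_prod:
  "word_weight x y z a \<pi> =
     (\<Prod>j\<in>{0..length \<pi>}. step_weight x y z ((a # \<pi> @ [0]) ! j) ((a # \<pi> @ [0]) ! (j + 1)))"
  by (induction \<pi> arbitrary: a) (simp_all add: prod.atLeast0_atMost_Suc_shift del: prod.cl_ivl_Suc)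

lemma word_weight_stat:
  "word_weight x 1 z 0 \<pi> = x ^ des \<pi> * z ^ plat \<pi>"
proof -
  let ?d = "\<lambda>j. pad \<pi> ! (j + 1) < pad \<pi> ! j" and ?p = "\<lambda>j. pad \<pi> ! j = pad \<pi> ! (j + 1)"
  have "word_weight x 1 z 0 \<pi> =
      (\<Prod>j\<in>{0..length \<pi>}. (if ?d j then x else 1) * (if ?p j then z else 1))"
    unfolding word_weight_prod pad_def
    by (intro prod.cong refl) (auto simp: step_weight_def)
  also have "\<dots> = (\<Prod>j\<in>{0..length \<pi>}. if ?d j then x else 1) *
                  (\<Prod>j\<in>{0..length \<pi>}. if ?p j then z else 1)"
    by (rule prod.distrib)
  also have "\<dots> = x ^ des \<pi> * z ^ plat \<pi>"
    unfolding des_def plat_def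
    by (simp add: prod.If_cases Int_def)
  finally show ?thesis .
qed

lemma coeff_linear_mult:
  "coeff ([:a, c:] * p) i = a * coeff p i + (if i = 0 then 0 else c * coeff p (i - 1))"
  for p :: "'a::comm_ring_1 poly"
  by (cases i) (auto simp: coeff_pCons)

lemma degree_word_weight:
  fixes x :: "'a::comm_ring_1"
  shows "degree (word_weight [:x, a:] [:y, b:] [:z, c:] l \<pi>) \<le> length \<pi> + 1"
proof (induction \<pi> arbitrary: l)
  case Nil
  then show ?case by (simp add: step_weight_def)
next
  case (Cons r \<pi>)
  have "degree (step_weight [:x, a:] [:y, b:] [:z, c:] l r) \<le> 1"
    by (simp add: step_weight_def)
  with Cons[of r] show ?case
    using degree_mult_le[of "step_weight [:x, a:] [:y, b:] [:z, c:] l r"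
        "word_weight [:x, a:] [:y, b:] [:z, c:] r \<pi>"]
    by simp
qed

text \<open>Along a line with direction \<open>(a, b, c)\<close>, the weight of a word \<open>\<pi>\<close> has degree at most
  \<open>length \<pi> + 1\<close>, and its coefficient in that degree is the weight of the word at \<open>(a, b, c)\<close>.\<close>

lemma coeff_word_weight:
  fixes x :: "'a::comm_ring_1"
  shows "coeff (word_weight [:x, a:] [:y, b:] [:z, c:] l \<pi>) (length \<pi> + 1)
           = word_weight a b c l \<pi>"
proof (induction \<pi> arbitrary: l)
  case Nil
  then show ?case by (simp add: step_weight_def)
next
  case (Cons r \<pi>)
  have "coeff (word_weight [:x, a:] [:y, b:] [:z, c:] r \<pi>) (Suc (Suc (length \<pi>))) = 0"
    by (rule coeff_eq_0) (use degree_word_weight[of x a y b z c r \<pi>] in simp)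
  with Cons[of r] show ?case
    by (auto simp: step_weight_def coeff_linear_mult simp del: mult_pCons_left)
qed

lemma word_weight_pos:
  fixes x :: "'a::linordered_semidom"
  assumes "x > 0" "y > 0" "z > 0"
  shows "word_weight x y z a \<pi> > 0"
  using assms by (induction \<pi> arbitrary: a) (auto simp: step_weight_def)

lemma of_real_word_weight:
  "of_real (word_weight x y z a \<pi>) =
     word_weight (of_real x) (of_real y) (of_real z) a \<pi>"
  by (induction \<pi> arbitrary: a) (auto simp: step_weight_def)

section \<open>Inserting the copies of the largest letter\<close>

text \<open>The word obtained by inserting \<open>k\<close> copies of the letter \<open>N\<close> after the first \<open>j\<close> letters.\<close>

definition insert_block :: "nat \<Rightarrow> 'a \<Rightarrow> nat \<Rightarrow> 'a list \<Rightarrow> 'a list" where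
  "insert_block k N j \<pi> = take j \<pi> @ replicate k N @ drop j \<pi>"

lemma insert_block_simps:
  "insert_block k N 0 \<pi> = replicate k N @ \<pi>"
  "insert_block k N (Suc j) (b # \<pi>) = b # insert_block k N j \<pi>"
  by (simp_all add: insert_block_def)

lemma word_weight_replicate:
  "word_weight x y z N (replicate k N @ \<pi>) = z ^ k * word_weight x y z N \<pi>"
  by (induction k) (simp_all add: step_weight_def mult.assoc)

text \<open>Inserting the block \<open>N\<^sup>k\<close> into a pair \<open>a b\<close> of smaller letters replaces the factor of this pair by
  \<open>Y Z\<^bsup>k-1\<^esup> X\<close>. Since every factor has derivative \<open>1\<close>, summing over all positions is the product rule.\<close>

lemma sum_word_weight_insert_block:
  fixes X Y Z :: "complex poly"
  assumes "pderiv X = 1" "pderiv Y = 1" "pderiv Z = 1"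
    and "k > 0" "a < N" "\<forall>b\<in>set \<pi>. b < N"
  shows "(\<Sum>j\<in>{..length \<pi>}. word_weight X Y Z a (insert_block k N j \<pi>))
           = X * Y * Z ^ (k - 1) * pderiv (word_weight X Y Z a \<pi>)"
  using assms
proof (induction \<pi> arbitrary: a)
  case Nil
  then obtain k' where k: "k = Suc k'" by (cases k) auto
  have "word_weight X Y Z a (replicate k N) = Y * (Z ^ k' * X)"
    using Nil.prems(5) word_weight_replicate[of X Y Z N k' "[]"]
    by (simp add: k step_weight_def)
  moreover have "pderiv (step_weight X Y Z a 0) = 1"
    using Nil.prems(1-3) by (simp add: step_weight_def)
  ultimately show ?case
    by (simp add: insert_block_simps k mult_ac)
next
  case (Cons b \<pi>)
  then obtain k' where k: "k = Suc k'" by (cases k) auto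
  have IH: "(\<Sum>j\<in>{..length \<pi>}. word_weight X Y Z b (insert_block k N j \<pi>))
           = X * Y * Z ^ k' * pderiv (word_weight X Y Z b \<pi>)"
    using Cons k by simp
  have d1: "pderiv (step_weight X Y Z a b) = 1"
    using Cons.prems by (simp add: step_weight_def)
  have "(\<Sum>j\<in>{..length (b # \<pi>)}. word_weight X Y Z a (insert_block k N j (b # \<pi>)))
      = word_weight X Y Z a (replicate k N @ b # \<pi>)
        + step_weight X Y Z a b * (\<Sum>j\<in>{..length \<pi>}. word_weight X Y Z b (insert_block k N j \<pi>))"
    by (simp add: sum.atMost_Suc_shift insert_block_simps sum_distrib_left del: sum.atMost_Suc)
  also have "word_weight X Y Z a (replicate k N @ b # \<pi>)
      = X * Y * Z ^ k' * word_weight X Y Z b \<pi>"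
    using Cons.prems by (simp add: k word_weight_replicate step_weight_def)
  also have "X * Y * Z ^ k' * word_weight X Y Z b \<pi> + step_weight X Y Z a b *
      (\<Sum>j\<in>{..length \<pi>}. word_weight X Y Z b (insert_block k N j \<pi>))
      = X * Y * Z ^ (k - 1) * pderiv (word_weight X Y Z a (b # \<pi>))"
    unfolding IH by (simp add: d1 k pderiv_mult algebra_simps)
  finally show ?case .
qed

text \<open>The Stirling condition is handled as the condition that every (not necessarily contiguous)
  subsequence \<open>x y x\<close> satisfies \<open>x \<le> y\<close>; in this form it is visibly inherited by subsequences.\<close>

lemma subseq_Cons_iff_nth:
  "subseq (x # xs) l \<longleftrightarrow> (\<exists>a<length l. l ! a = x \<and> subseq xs (drop (Suc a) l))"
proof
  assume "subseq (x # xs) l"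
  then obtain us vs where "l = us @ x # vs" "subseq xs vs"
    by (blast dest: list_emb_ConsD)
  then show "\<exists>a<length l. l ! a = x \<and> subseq xs (drop (Suc a) l)"
    by (intro exI[of _ "length us"]) auto
next
  assume "\<exists>a<length l. l ! a = x \<and> subseq xs (drop (Suc a) l)"
  then obtain a where a: "a < length l" "l ! a = x" "subseq xs (drop (Suc a) l)" by blast
  then have "subseq (x # xs) (drop a l)"
    by (metis Cons_nth_drop_Suc subseq_Cons2)
  then show "subseq (x # xs) l"
    by (metis append_take_drop_id subseq_drop_many)
qed

lemma subseq3_iff_nth:
  "subseq [x, y, z] l \<longleftrightarrow>
     (\<exists>a b c. a < b \<and> b < c \<and> c < length l \<and> l ! a = x \<and> l ! b = y \<and> l ! c = z)"
proof
  assume "subseq [x, y, z] l"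
  then obtain a where a: "a < length l" "l ! a = x" "subseq [y, z] (drop (Suc a) l)"
    using subseq_Cons_iff_nth[of x "[y, z]" l] by blast
  from a(3) obtain b where b: "b < length l - Suc a" "l ! (Suc a + b) = y"
      "subseq [z] (drop (Suc b) (drop (Suc a) l))"
    using subseq_Cons_iff_nth[of y "[z]" "drop (Suc a) l"] by auto
  from b(3) obtain c where c: "c < length l - Suc (Suc a + b)" "l ! (Suc (Suc a + b) + c) = z"
    by (auto simp: subseq_singleton_left in_set_conv_nth add_ac)
  show "\<exists>a b c. a < b \<and> b < c \<and> c < length l \<and> l ! a = x \<and> l ! b = y \<and> l ! c = z"
    using a b c
    by (intro exI[of _ a] exI[of _ "Suc a + b"] exI[of _ "Suc (Suc a + b) + c"]) simp
next
  assume "\<exists>a b c. a < b \<and> b < c \<and> c < length l \<and> l ! a = x \<and> l ! b = y \<and> l ! c = z"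
  then obtain a b c where *: "a < b" "b < c" "c < length l" "l ! a = x" "l ! b = y" "l ! c = z"
    by blast
  have "subseq [z] (drop (Suc b) l)"
    using * unfolding subseq_Cons_iff_nth[of z]
    by (intro exI[of _ "c - Suc b"]) auto
  then have "subseq [y, z] (drop (Suc a) l)"
    using * unfolding subseq_Cons_iff_nth[of y]
    by (intro exI[of _ "b - Suc a"]) auto
  then show "subseq [x, y, z] l"
    using * unfolding subseq_Cons_iff_nth[of x]
    by (intro exI[of _ a]) auto
qed

lemma set_stirling_mset: "set_mset (stirling_mset n m) \<subseteq> {1..n}"
  by (auto simp: stirling_mset_def set_mset_sum split: if_splits)

lemma stirling_perms_iff:
  "\<pi> \<in> stirling_perms n m \<longleftrightarrow>
     mset \<pi> = stirling_mset n m \<and> (\<forall>x y. subseq [x, y, x] \<pi> \<longrightarrow> x \<le> y)"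
proof -
  have range: "\<pi> ! a \<in> {1..n}" if "mset \<pi> = stirling_mset n m" "a < length \<pi>" for a
  proof -
    have "\<pi> ! a \<in> set_mset (mset \<pi>)" using that(2) by simp
    then show ?thesis using set_stirling_mset[of n m] unfolding that(1) by blast
  qed
  show ?thesis
  proof
    assume *: "\<pi> \<in> stirling_perms n m"
    then have ms: "mset \<pi> = stirling_mset n m"
      by (simp add: stirling_perms_def permutations_of_multiset_def)
    moreover have "x \<le> y" if s: "subseq [x, y, x] \<pi>" for x y
    proof -
      obtain a b c where abc: "a < b" "b < c" "c < length \<pi>" "\<pi> ! a = x" "\<pi> ! b = y" "\<pi> ! c = x"
        using s unfolding subseq3_iff_nth by blast
      then have "x \<in> {1..n}" using range[OF ms, of a] by simp
      then show "x \<le> y" using * abc by (auto simp: stirling_perms_def)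
    qed
    ultimately show "mset \<pi> = stirling_mset n m \<and> (\<forall>x y. subseq [x, y, x] \<pi> \<longrightarrow> x \<le> y)"
      by blast
  next
    assume *: "mset \<pi> = stirling_mset n m \<and> (\<forall>x y. subseq [x, y, x] \<pi> \<longrightarrow> x \<le> y)"
    have "k \<le> \<pi> ! b" if "a < b" "b < c" "c < length \<pi>" "\<pi> ! a = k" "\<pi> ! c = k" for k a b c
    proof -
      have "subseq [k, \<pi> ! b, k] \<pi>" unfolding subseq3_iff_nth using that by blast
      then show ?thesis using * by blast
    qed
    then show "\<pi> \<in> stirling_perms n m"
      using * by (simp add: stirling_perms_def permutations_of_multiset_def)
  qed
qed

lemma stirling_perms_le: "\<pi> \<in> stirling_perms n m \<Longrightarrow> b \<in> set \<pi> \<Longrightarrow> b \<le> n"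
  using set_stirling_mset[of n m] unfolding stirling_perms_iff
  by (metis atLeastAtMost_iff set_mset_mset subsetD)

lemma finite_stirling_perms [simp]: "finite (stirling_perms n m)"
  by (simp add: stirling_perms_def)

lemma length_stirling_perms: "\<pi> \<in> stirling_perms n m \<Longrightarrow> length \<pi> = (\<Sum>k=1..n. m k)"
proof -
  assume "\<pi> \<in> stirling_perms n m"
  then have "length \<pi> = size (stirling_mset n m)"
    by (metis size_mset stirling_perms_iff)
  also have "\<dots> = (\<Sum>k=1..n. m k)"
    by (simp add: stirling_mset_def size_multiset_sum)
  finally show ?thesis .
qed

lemma stirling_mset_Suc:
  "stirling_mset (Suc n) m = stirling_mset n m + replicate_mset (m (Suc n)) (Suc n)"
  by (simp add: stirling_mset_def)

lemma subseq_drop_notin: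
  "subseq (x # xs) (us @ vs) \<Longrightarrow> x \<notin> set us \<Longrightarrow> subseq (x # xs) vs"
  by (induction us) (auto simp: subseq_Cons2_neq)

lemma insert_block_stirling:
  assumes "\<pi> \<in> stirling_perms n m"
  shows "insert_block (m (Suc n)) (Suc n) j \<pi> \<in> stirling_perms (Suc n) m"
proof -
  let ?N = "Suc n"
  let ?\<sigma> = "insert_block (m ?N) ?N j \<pi>"
  have lt: "b \<le> n" if "b \<in> set \<pi>" for b
    using stirling_perms_le[OF assms that] .
  have m\<pi>: "mset \<pi> = mset (take j \<pi>) + mset (drop j \<pi>)"
    by (metis append_take_drop_id mset_append)
  have "mset ?\<sigma> = stirling_mset ?N m"
    using assms m\<pi> by (simp add: stirling_mset_Suc insert_block_def stirling_perms_iff add_ac)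
  moreover have "x \<le> y" if s: "subseq [x, y, x] ?\<sigma>" for x y
  proof -
    have xN: "x \<le> ?N"
    proof -
      have "x \<in> set ?\<sigma>"
        using s unfolding subseq_Cons_iff_nth[of x] by auto
      moreover have "set ?\<sigma> \<subseteq> insert ?N (set \<pi>)"
        using set_take_subset[of j \<pi>] set_drop_subset[of j \<pi>]
        unfolding insert_block_def by auto
      ultimately show ?thesis using lt[of x] by auto
    qed
    have "?N \<notin> set \<pi>" using lt[of ?N] by auto
    then have N1: "?N \<notin> set (take j \<pi>)" "?N \<notin> set (drop j \<pi>)"
      using set_take_subset[of j \<pi>] set_drop_subset[of j \<pi>] by blast+
    \<comment> \<open>A triple avoiding the largest letter already occurs in \<open>\<pi>\<close>.\<close>
    have filt: "filter (\<lambda>b. b \<noteq> ?N) ?\<sigma> = \<pi>"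
    proof -
      have "filter (\<lambda>b. b \<noteq> ?N) ?\<sigma> =
          filter (\<lambda>b. b \<noteq> ?N) (take j \<pi>) @ filter (\<lambda>b. b \<noteq> ?N) (drop j \<pi>)"
        by (simp add: insert_block_def)
      also have "\<dots> = filter (\<lambda>b. b \<noteq> ?N) \<pi>"
        by (metis append_take_drop_id filter_append)
      also have "\<dots> = \<pi>" using lt by (intro filter_True) fastforce
      finally show ?thesis .
    qed
    consider "y = ?N" | "x = ?N" "y \<noteq> ?N" | "x \<noteq> ?N" "y \<noteq> ?N" by blast
    then show ?thesis
    proof cases
      case 1 then show ?thesis using xN by simp
    next
      case 2
      \<comment> \<open>This cannot happen: after a smaller letter behind the block there is no further \<open>Suc n\<close>.\<close>
      have "subseq [?N, y, ?N] (take j \<pi> @ replicate (m ?N) ?N @ drop j \<pi>)"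
        using s unfolding 2(1) insert_block_def .
      then have "subseq [?N, y, ?N] (replicate (m ?N) ?N @ drop j \<pi>)"
        using N1(1) by (rule subseq_drop_notin)
      then have "subseq [y, ?N] (replicate (m ?N) ?N @ drop j \<pi>)"
        by (rule subseq_Cons')
      then have "subseq [y, ?N] (drop j \<pi>)"
        by (rule subseq_drop_notin) (use 2 in simp)
      then have "?N \<in> set (drop j \<pi>)"
        unfolding subseq_singleton_left[symmetric] by (rule subseq_Cons')
      with N1 show ?thesis by simp
    next
      case 3
      have "subseq (filter (\<lambda>b. b \<noteq> ?N) [x, y, x]) (filter (\<lambda>b. b \<noteq> ?N) ?\<sigma>)"
        using s by (rule subseq_filter)
      then have "subseq [x, y, x] \<pi>" using 3 filt by simp
      then show ?thesis using assms by (auto simp: stirling_perms_iff)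
    qed
  qed
  ultimately show ?thesis by (simp add: stirling_perms_iff)
qed

text \<open>Between two copies of the largest letter only that letter may occur, so its copies form a
  block; removing it leaves a Stirling permutation.\<close>

lemma stirling_perms_Suc_cases:
  assumes "\<sigma> \<in> stirling_perms (Suc n) m"
  obtains \<pi> j where "\<pi> \<in> stirling_perms n m" "j \<le> length \<pi>"
    "\<sigma> = insert_block (m (Suc n)) (Suc n) j \<pi>"
proof -
  let ?N = "Suc n"
  define u where "u = takeWhile (\<lambda>b. b \<noteq> ?N) \<sigma>"
  define r where "r = dropWhile (\<lambda>b. b \<noteq> ?N) \<sigma>"
  define w where "w = takeWhile (\<lambda>b. b = ?N) r"
  define v where "v = dropWhile (\<lambda>b. b = ?N) r"
  have \<sigma>: "\<sigma> = u @ w @ v" by (simp add: u_def w_def v_def r_def)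
  have uN: "?N \<notin> set u" unfolding u_def by (auto dest: set_takeWhileD)
  have w: "w = replicate (length w) ?N"
    unfolding w_def by (metis (mono_tags) replicate_eqI set_takeWhileD)
  have vN: "?N \<notin> set v"
  proof
    assume vin: "?N \<in> set v"
    then obtain y v' where v: "v = y # v'" by (cases v) auto
    have y: "y \<noteq> ?N"
      using v v_def by (metis (mono_tags) hd_dropWhile list.sel(1) list.distinct(1))
    \<comment> \<open>The first letter of \<open>v\<close> lies between a copy of the largest letter in \<open>w\<close> and the one in \<open>v\<close>.\<close>
    have "w \<noteq> []"
    proof
      assume "w = []"
      then have "r = v" using v_def w_def
        by (metis append_Nil takeWhile_dropWhile_id)
      then have "y = hd r" "r \<noteq> []" using v by auto
      then show False using y hd_dropWhile[of "\<lambda>b. b \<noteq> ?N" \<sigma>] unfolding r_def by auto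
    qed
    then have "?N \<in> set w" using w
      by (metis length_0_conv in_set_replicate)
    moreover have "?N \<in> set v'" using vin v y by auto
    ultimately have "subseq ([?N] @ [y, ?N]) (w @ v)"
      unfolding v by (intro list_emb_append_mono) (auto simp: subseq_singleton_left)
    then have "subseq [?N, y, ?N] \<sigma>" unfolding \<sigma> by (simp add: subseq_drop_many)
    then have "?N \<le> y" using assms by (auto simp: stirling_perms_iff)
    moreover have "y \<le> ?N"
      using stirling_perms_le[OF assms, of y] \<sigma> v by auto
    ultimately show False using y by simp
  qed
  have ms: "mset u + mset w + mset v = stirling_mset n m + replicate_mset (m ?N) ?N"
    using assms \<sigma> by (simp add: stirling_perms_iff stirling_mset_Suc add.assoc)
  have "count (stirling_mset n m) ?N = 0"
    using set_stirling_mset[of n m] by (metis atLeastAtMost_iff not_in_iff not_less_eq_eq order_refl subsetD)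
  moreover have "count (mset w) ?N = length w"
    by (subst w) simp
  moreover have "count (mset u) ?N = 0" "count (mset v) ?N = 0"
    using uN vN by (simp_all add: count_eq_zero_iff)
  ultimately have len: "length w = m ?N"
    using arg_cong[OF ms, of "\<lambda>A. count A ?N"] by (simp only: count_union) simp
  then have w': "w = replicate (m ?N) ?N" using w by simp
  show ?thesis
  proof
    have "mset (u @ v) = stirling_mset n m"
      using ms unfolding w' by simp
    moreover have "subseq (u @ v) \<sigma>"
      unfolding \<sigma> by (intro list_emb_append_mono) auto
    ultimately show "u @ v \<in> stirling_perms n m"
      using assms subseq_order.order_trans[of _ "u @ v" \<sigma>] by (auto simp: stirling_perms_iff)
    show "length u \<le> length (u @ v)" by simp
    show "\<sigma> = insert_block (m ?N) ?N (length u) (u @ v)"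
      by (simp add: insert_block_def \<sigma> w')
  qed
qed

lemma insert_block_inject:
  assumes eq: "insert_block k N j \<pi> = insert_block k N j' \<pi>'"
    and "k > 0" "N \<notin> set \<pi>" "N \<notin> set \<pi>'" "j \<le> length \<pi>" "j' \<le> length \<pi>'"
  shows "j = j' \<and> \<pi> = \<pi>'"
proof -
  \<comment> \<open>The first occurrence of \<open>N\<close> recovers the position of the block.\<close>
  have len: "length (takeWhile (\<lambda>b. b \<noteq> N) (insert_block k N i \<rho>)) = i"
    if "N \<notin> set \<rho>" "i \<le> length \<rho>" for i \<rho>
  proof -
    have "takeWhile (\<lambda>b. b \<noteq> N) (insert_block k N i \<rho>) = take i \<rho>"
      unfolding insert_block_def using that \<open>k > 0\<close>
      by (subst takeWhile_append2) (auto dest: in_set_takeD simp: takeWhile_append gr0_conv_Suc)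
    then show ?thesis using that by simp
  qed
  have j: "j = j'" using len[of \<pi> j] len[of \<pi>' j'] assms by simp
  then have "take j \<pi> = take j \<pi>' \<and> drop j \<pi> = drop j \<pi>'"
    using eq assms by (auto simp: insert_block_def append_eq_append_conv)
  then show ?thesis using j by (metis append_take_drop_id)
qed

lemma bij_betw_insert_block:
  assumes "m (Suc n) > 0"
  shows "bij_betw (\<lambda>(\<pi>, j). insert_block (m (Suc n)) (Suc n) j \<pi>)
           (SIGMA \<pi>:stirling_perms n m. {..length \<pi>}) (stirling_perms (Suc n) m)"
  unfolding bij_betw_def
proof
  have "Suc n \<notin> set \<pi>" if "\<pi> \<in> stirling_perms n m" for \<pi>
    using stirling_perms_le[OF that, of "Suc n"] by auto
  then show "inj_on (\<lambda>(\<pi>, j). insert_block (m (Suc n)) (Suc n) j \<pi>)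
      (SIGMA \<pi>:stirling_perms n m. {..length \<pi>})"
    using assms by (auto intro!: inj_onI dest!: insert_block_inject)
  show "(\<lambda>(\<pi>, j). insert_block (m (Suc n)) (Suc n) j \<pi>) `
      (SIGMA \<pi>:stirling_perms n m. {..length \<pi>}) = stirling_perms (Suc n) m"
  proof
    show "stirling_perms (Suc n) m \<subseteq> (\<lambda>(\<pi>, j). insert_block (m (Suc n)) (Suc n) j \<pi>) `
        (SIGMA \<pi>:stirling_perms n m. {..length \<pi>})"
    proof
      fix \<sigma> assume "\<sigma> \<in> stirling_perms (Suc n) m"
      then obtain \<pi> j where "\<pi> \<in> stirling_perms n m" "j \<le> length \<pi>"
          "\<sigma> = insert_block (m (Suc n)) (Suc n) j \<pi>"
        by (rule stirling_perms_Suc_cases)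
      then show "\<sigma> \<in> (\<lambda>(\<pi>, j). insert_block (m (Suc n)) (Suc n) j \<pi>) `
          (SIGMA \<pi>:stirling_perms n m. {..length \<pi>})"
        by (intro image_eqI[of _ _ "(\<pi>, j)"]) auto
    qed
  qed (auto intro: insert_block_stirling)
qed

lemma stirling_perms_0: "stirling_perms 0 m = {[]}"
  by (auto simp: stirling_perms_iff stirling_mset_def)

lemma stirling_perms_nonempty: "stirling_perms n m \<noteq> {}"
proof (induction n)
  case (Suc n)
  then obtain \<pi> where "\<pi> \<in> stirling_perms n m" by blast
  then show ?case using insert_block_stirling[of \<pi> n m 0] by blast
qed (simp add: stirling_perms_0)

lemma stirling_sum_Suc:
  fixes X Y Z :: "complex poly"
  assumes "pderiv X = 1" "pderiv Y = 1" "pderiv Z = 1" "m (Suc n) > 0"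
  shows "stirling_sum X Y Z (Suc n) m
           = X * Y * Z ^ (m (Suc n) - 1) * pderiv (stirling_sum X Y Z n m)"
proof -
  have "stirling_sum X Y Z (Suc n) m =
      (\<Sum>(\<pi>, j)\<in>(SIGMA \<pi>:stirling_perms n m. {..length \<pi>}).
         word_weight X Y Z 0 (insert_block (m (Suc n)) (Suc n) j \<pi>))"
    unfolding stirling_sum_def
    using sum.reindex_bij_betw[OF bij_betw_insert_block[of m n, OF assms(4)],
        of "word_weight X Y Z 0", symmetric]
    by (simp add: case_prod_beta')
  also have "\<dots> = (\<Sum>\<pi>\<in>stirling_perms n m. \<Sum>j\<in>{..length \<pi>}.
         word_weight X Y Z 0 (insert_block (m (Suc n)) (Suc n) j \<pi>))"
    by (rule sum.Sigma[symmetric]) auto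
  also have "\<dots> = (\<Sum>\<pi>\<in>stirling_perms n m.
         X * Y * Z ^ (m (Suc n) - 1) * pderiv (word_weight X Y Z 0 \<pi>))"
    using assms
    by (intro sum.cong refl sum_word_weight_insert_block)
       (auto simp: less_Suc_eq_le intro: stirling_perms_le)
  also have "\<dots> = X * Y * Z ^ (m (Suc n) - 1) * pderiv (stirling_sum X Y Z n m)"
    using higher_pderiv_sum[of 1 "word_weight X Y Z 0" "stirling_perms n m"]
    by (simp add: stirling_sum_def sum_distrib_left)
  finally show ?thesis .
qed

section \<open>Stability\<close>

text \<open>In a positive direction every word contributes a positive coefficient in the top degree, so the
  leading terms cannot cancel.\<close>

lemma degree_stirling_sum:
  assumes "a > 0" "b > 0" "c > 0"
  shows "degree (stirling_sum [:x, complex_of_real a:] [:y, of_real b:] [:z, of_real c:] n m)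
           \<ge> (\<Sum>k=1..n. m k) + 1" (is "degree ?F \<ge> ?M + 1")
proof (rule le_degree)
  have "coeff ?F (?M + 1) = (\<Sum>\<pi>\<in>stirling_perms n m.
      coeff (word_weight [:x, of_real a:] [:y, of_real b:] [:z, of_real c:] 0 \<pi>) (length \<pi> + 1))"
    unfolding stirling_sum_def coeff_sum
    by (intro sum.cong refl) (simp add: length_stirling_perms)
  also have "\<dots> = of_real (\<Sum>\<pi>\<in>stirling_perms n m. word_weight a b c 0 \<pi>)"
    by (simp only: coeff_word_weight of_real_word_weight of_real_sum)
  finally show "coeff ?F (?M + 1) \<noteq> 0"
    using sum_pos[OF finite_stirling_perms stirling_perms_nonempty, of n m "word_weight a b c 0"]
      word_weight_pos[OF assms] by (simp del: of_real_sum)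
qed

text \<open>Stability of the generating polynomial. The induction step restricts to the line through
  \<open>(x, y, z)\<close> in direction \<open>(1, 1, 1)\<close>.\<close>

lemma stirling_sum_stable:
  fixes x y z :: complex
  assumes "\<And>k. k \<in> {1..n} \<Longrightarrow> m k > 0"
    and "Im x > 0" "Im y > 0" "Im z > 0"
  shows "stirling_sum x y z n m \<noteq> 0"
  using assms
proof (induction n arbitrary: x y z)
  case 0
  then show ?case by (auto simp: stirling_sum_def stirling_perms_0 step_weight_def)
next
  case (Suc n)
  define P where "P = (\<lambda>n. stirling_sum [:x, 1:] [:y, 1:] [:z, 1:] n m)"
  have nz: "poly (P n) t \<noteq> 0" if "Im t \<ge> 0" for t
    unfolding P_def poly_stirling_sum using Suc.prems that
    by (intro Suc.IH) auto
  have "degree (P n) > 0"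
    using degree_stirling_sum[of 1 1 1 m n x y z] by (simp add: P_def)
  then have "poly (pderiv (P n)) 0 \<noteq> 0"
    using nz by (intro pderiv_no_roots) auto
  moreover have "P (Suc n) = [:x, 1:] * [:y, 1:] * [:z, 1:] ^ (m (Suc n) - 1) * pderiv (P n)"
    unfolding P_def using Suc.prems(1)[of "Suc n"]
    by (intro stirling_sum_Suc) (auto simp: pderiv_pCons)
  moreover have "stirling_sum x y z (Suc n) m = poly (P (Suc n)) 0"
    by (simp add: P_def poly_stirling_sum)
  moreover have "x \<noteq> 0" "y \<noteq> 0" "z \<noteq> 0"
    using Suc.prems by auto
  ultimately show ?case by simp
qed

section \<open>The coefficients in the plateau variable\<close>

text \<open>The coefficient of \<open>t\<^sup>i\<close> in \<open>F\<^sub>n(x + d t, 1 + \<i> d + d t, \<i> d + t)\<close>. For \<open>d > 0\<close> the direction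
  \<open>(d, d, 1)\<close> is positive and the base point lies in the open upper half-plane whenever \<open>x\<close> does;
  for \<open>d = 0\<close> the polynomial in \<open>t\<close> is \<open>F\<^sub>n(x, 1, t)\<close>.\<close>

definition perturbed_coeff ::
    "nat \<Rightarrow> (nat \<Rightarrow> nat) \<Rightarrow> nat \<Rightarrow> complex \<Rightarrow> real \<Rightarrow> complex" where
  "perturbed_coeff n m i x d =
     coeff (stirling_sum [:x, of_real d:] [:1 + \<i> * of_real d, of_real d:]
       [:\<i> * of_real d, 1:] n m) i"

lemma perturbed_coeff_nonzero:
  assumes "\<And>k. k \<in> {1..n} \<Longrightarrow> m k > 0" "i \<le> (\<Sum>k=1..n. m k)" "Im x > 0" "d > 0"
  shows "perturbed_coeff n m i x d \<noteq> 0"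
  unfolding perturbed_coeff_def
proof (rule coeff_nonzero_of_no_roots)
  fix t :: complex assume t: "Im t \<ge> 0"
  then have "d * Im t \<ge> 0" using assms by simp
  then show "poly (stirling_sum [:x, of_real d:] [:1 + \<i> * of_real d, of_real d:]
      [:\<i> * of_real d, 1:] n m) t \<noteq> 0"
    unfolding poly_stirling_sum using assms t
    by (intro stirling_sum_stable) (auto simp: add_pos_nonneg mult.commute)
next
  show "i \<le> degree (stirling_sum [:x, complex_of_real d:] [:1 + \<i> * of_real d, of_real d:]
      [:\<i> * of_real d, 1:] n m)"
    using degree_stirling_sum[of d d 1 m n x "1 + \<i> * of_real d" "\<i> * of_real d"] assms by simp
qed

lemma perturbed_coeff_0:
  "perturbed_coeff n m i x 0 = poly (map_poly complex_of_real (stirling_poly n m i)) x"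
proof -
  have "word_weight [:x:] 1 [:0, 1:] 0 \<pi> = monom (x ^ des \<pi>) (plat \<pi>)" for \<pi>
    by (simp add: word_weight_stat monom_altdef poly_const_pow)
  then have "perturbed_coeff n m i x 0 =
      (\<Sum>\<pi>\<in>stirling_perms n m. if plat \<pi> = i then x ^ des \<pi> else 0)"
    by (simp add: perturbed_coeff_def stirling_sum_def coeff_sum one_pCons)
  also have "\<dots> = (\<Sum>\<pi>\<in>{\<pi> \<in> stirling_perms n m. plat \<pi> = i}. x ^ des \<pi>)"
    by (simp add: sum.inter_filter)
  also have "\<dots> = poly (map_poly complex_of_real (stirling_poly n m i)) x"
  proof -
    have "map_poly complex_of_real (stirling_poly n m i) =
        (\<Sum>\<pi>\<in>{\<pi> \<in> stirling_perms n m. plat \<pi> = i}. monom 1 (des \<pi>))"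
      unfolding stirling_poly_def
      by (rule poly_eqI) (simp add: coeff_map_poly coeff_sum if_distrib cong: if_cong)
    then show ?thesis by (simp add: poly_sum poly_monom)
  qed
  finally show ?thesis .
qed

lemma coeff_word_weight_holomorphic:
  "(\<lambda>x. coeff (word_weight [:x, a:] [:y, b:] [:z, c:] l \<pi>) i) holomorphic_on S"
proof (induction \<pi> arbitrary: l i)
  case Nil
  have "(\<lambda>x. coeff [:x, a:] i) holomorphic_on S"
    by (cases i) (auto simp: coeff_pCons split: nat.splits intro!: holomorphic_intros)
  then show ?case by (cases "0 < l") (simp_all add: step_weight_def)
next
  case (Cons r \<pi>)
  show ?case
    using Cons[of r i] Cons[of r "i - 1"]
    by (cases "r < l"; cases "l < r"; cases "i = 0")
       (auto simp: step_weight_def coeff_linear_mult simp del: mult_pCons_left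
             intro!: holomorphic_intros)
qed

lemma coeff_word_weight_continuous:
  fixes x a y b z c :: "'b::topological_space \<Rightarrow> complex"
  assumes [continuous_intros]: "continuous_on S x" "continuous_on S a" "continuous_on S y"
    "continuous_on S b" "continuous_on S z" "continuous_on S c"
  shows "continuous_on S
    (\<lambda>p. coeff (word_weight [:x p, a p:] [:y p, b p:] [:z p, c p:] l \<pi>) i)"
proof (induction \<pi> arbitrary: l i)
  case Nil
  have "continuous_on S (\<lambda>p. coeff [:f p, g p:] i)"
    if "continuous_on S f" "continuous_on S g" for f g :: "'b \<Rightarrow> complex"
    using that by (cases i; cases "i - 1") (auto simp: coeff_pCons)
  then show ?case using assms by (cases "0 < l") (auto simp: step_weight_def)
next
  case (Cons r \<pi>)
  show ?case
    using Cons[of r i] Cons[of r "i - 1"]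
    by (cases "r < l"; cases "l < r"; cases "i = 0")
       (auto simp: step_weight_def coeff_linear_mult simp del: mult_pCons_left
             intro!: continuous_intros)
qed

lemma perturbed_coeff_holomorphic: "(\<lambda>x. perturbed_coeff n m i x d) holomorphic_on S"
  unfolding perturbed_coeff_def stirling_sum_def coeff_sum
  by (intro holomorphic_intros coeff_word_weight_holomorphic)

lemma perturbed_coeff_continuous:
  "continuous_on S (\<lambda>(x, d). perturbed_coeff n m i x d)"
  unfolding perturbed_coeff_def stirling_sum_def coeff_sum case_prod_beta
  by (intro continuous_intros coeff_word_weight_continuous)

text \<open>The limit \<open>d \<rightarrow> 0\<close> is uniform for \<open>x\<close> in a compact set \<open>K\<close>, by uniform continuity on
  \<open>K \<times> [0, 1]\<close>.\<close>

lemma perturbed_coeff_uniform_limit: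
  assumes "compact K"
  shows "uniform_limit K (\<lambda>N x. perturbed_coeff n m i x (1 / real (Suc N)))
           (\<lambda>x. perturbed_coeff n m i x 0) sequentially"
proof (rule uniform_limitI)
  fix e :: real assume "e > 0"
  have "uniformly_continuous_on (K \<times> {0..1}) (\<lambda>(x, d). perturbed_coeff n m i x d)"
    using assms by (intro compact_uniformly_continuous perturbed_coeff_continuous compact_Times) auto
  then obtain \<eta> where \<eta>: "\<eta> > 0" and close: "\<And>p q. p \<in> K \<times> {0..1} \<Longrightarrow> q \<in> K \<times> {0..1} \<Longrightarrow>
      dist q p < \<eta> \<Longrightarrow> dist ((\<lambda>(x, d). perturbed_coeff n m i x d) q)
        ((\<lambda>(x, d). perturbed_coeff n m i x d) p) < e"
    using \<open>e > 0\<close> unfolding uniformly_continuous_on_def by metis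
  have "eventually (\<lambda>N. 1 / real (Suc N) < \<eta>) sequentially"
    using \<eta> LIMSEQ_inverse_real_of_nat by (auto simp: inverse_eq_divide dest: order_tendstoD(2))
  then show "\<forall>\<^sub>F N in sequentially. \<forall>x\<in>K.
      dist (perturbed_coeff n m i x (1 / real (Suc N))) (perturbed_coeff n m i x 0) < e"
  proof eventually_elim
    case (elim N)
    show ?case
    proof
      fix x assume "x \<in> K"
      then show "dist (perturbed_coeff n m i x (1 / real (Suc N))) (perturbed_coeff n m i x 0) < e"
        using close[of "(x, 0)" "(x, 1 / real (Suc N))"] elim by (simp add: dist_Pair_Pair)
    qed
  qed
qed

lemma stirling_poly_upper_half_plane:
  assumes "\<And>k. k \<in> {1..n} \<Longrightarrow> m k > 0" "i \<le> (\<Sum>k=1..n. m k)"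
    and "stirling_poly n m i \<noteq> 0" "Im w > 0"
  shows "poly (map_poly complex_of_real (stirling_poly n m i)) w \<noteq> 0"
proof
  let ?H = "{x. Im x > 0}"
  let ?p = "map_poly complex_of_real (stirling_poly n m i)"
  let ?g = "\<lambda>x. perturbed_coeff n m i x 0"
  assume root: "poly ?p w = 0"
  \<comment> \<open>A polynomial that is constant on the half-plane and has a root there has infinitely many roots.\<close>
  have "\<not> ?g constant_on ?H"
  proof
    assume "?g constant_on ?H"
    then have "\<forall>x\<in>?H. poly ?p x = 0"
      using root assms(4) unfolding constant_on_def perturbed_coeff_0 by (metis mem_Collect_eq)
    then have "?H \<subseteq> {x. poly ?p x = 0}" by auto
    moreover have "?p \<noteq> 0" using assms(3) by (simp add: map_poly_eq_0_iff)
    ultimately have "finite ?H" using poly_roots_finite finite_subset by blast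
    moreover have "infinite ?H"
    proof
      assume "finite ?H"
      moreover have "open ?H" by (rule open_halfspace_Im_gt)
      ultimately show False using assms(4) finite_imp_not_open by blast
    qed
    ultimately show False by simp
  qed
  have "?g w \<noteq> 0"
  proof (rule Hurwitz_no_zeros[of ?H "\<lambda>N x. perturbed_coeff n m i x (1 / real (Suc N))" ?g])
    show "open ?H" by (rule open_halfspace_Im_gt)
    show "connected ?H" by (intro convex_connected convex_halfspace_Im_gt)
    show "(\<lambda>x. perturbed_coeff n m i x (1 / real (Suc N))) holomorphic_on ?H" for N
      by (rule perturbed_coeff_holomorphic)
    show "?g holomorphic_on ?H" by (rule perturbed_coeff_holomorphic)
    show "uniform_limit K (\<lambda>N x. perturbed_coeff n m i x (1 / real (Suc N))) ?g sequentially"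
      if "compact K" "K \<subseteq> ?H" for K
      using that(1) by (rule perturbed_coeff_uniform_limit)
    show "perturbed_coeff n m i x (1 / real (Suc N)) \<noteq> 0" if "x \<in> ?H" for N x
      using that assms(1,2) by (intro perturbed_coeff_nonzero) auto
    show "\<not> ?g constant_on ?H" by fact
    show "w \<in> ?H" using assms(4) by simp
  qed
  with root show False by (simp add: perturbed_coeff_0)
qed

theorem corollary3p3:
  fixes n M i :: nat and m :: "nat \<Rightarrow> nat"
  assumes "n \<ge> 1"
    and "\<And>k. k \<in> {1..n} \<Longrightarrow> m k > 0"
    and "(\<Sum>k=1..n. m k) = M"
    and "i \<le> M - 1"
  shows "only_real_roots (stirling_poly n m i)"
proof (cases "stirling_poly n m i = 0")
  case False
  let ?p = "map_poly complex_of_real (stirling_poly n m i)"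
  have nz: "poly ?p w \<noteq> 0" if "Im w > 0" for w
    using assms False that by (intro stirling_poly_upper_half_plane) auto
  have "z \<in> \<real>" if "poly ?p z = 0" for z
  proof -
    have "poly ?p (cnj z) = 0"
      using that by (subst real_poly_cnj_root_iff) (auto simp: coeff_map_poly)
    then have "\<not> Im (cnj z) > 0" "\<not> Im z > 0" using nz that by blast+
    then show ?thesis by (simp add: complex_is_Real_iff)
  qed
  then show ?thesis by (simp add: only_real_roots_def)
qed (simp add: only_real_roots_def)

end
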